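(* There is an absolute constant $C$ such that the following holds. Let $0<\delta<1$ with $1/\delta\in\mathbb{N}$, let $z\in\mathbb{Z}^2$, $\rho\in\Gamma$, and let $w$ be a weight in $\mathbb{R}^2$. If $w\in A^S_{1,\rho,z}$, i.e. $[w]_{A^S_{1,\rho,z}}<\infty$, then for every $f$ $$\|\widetilde{M}_{\rho,\delta}f\|_{L^1(Q_z,w)}\le C\,\delta^{-\frac54}\,[w]_{A^S_{1,\rho,z}}\,\|f\|_{L^1(7Q_z,w)}.$$
   Context: A weight is a non-negative locally integrable function on $\mathbb{R}^2$; $L^p(E,w)=L^p(E,w\,dx)$; $|E|$ is Lebesgue measure. Negative powers of $w$ are $+\infty$ where $w=0$, and $0\cdot\infty=0$. For a square $Q$, $CQ$ denotes the square concentric with $Q$ with sidelength $C$ times that of $Q$. Fix $\delta\in(0,1)$ with $1/\delta$ an integer and set $u=1/\delta^2$. For $z\in\mathbb{Z}^2$, $Q_z$ is the axis-parallel square of sidelength $1$ with lower left vertex $z$. It is divided by the grid $\delta\mathbb{Z}^2$ into $u$ squares $Q_z(1),\dots,Q_z(u)$ of sidelength $\delta$ (partitioning $Q_z$), with centers $x_1,\dots,x_u$; $Q_z^*=\{x_1,\dots,x_u\}$. For $x\in Q_z$, $x^*$ is the center of the square $Q_z(i)$ containing $x$. $\Gamma$ is the family of all functions $\rho:Q_z^*\to[1,2]\cap\delta\mathbb{Z}$. $S(x,r)$ denotes the $1$-skeleton (boundary, union of four sides) of the axis-parallel square with center $x$ and sidelength $2r$. Selection of sides: for each $z$ and each $\rho\in\Gamma$,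 fix a choice $\Phi$ of one side $l^\rho_{i,z}$ of each $S(x_i,\rho(x_i))$, $i=1,\dots,u$, such that every line parallel to a coordinate axis contains at most $C_0\,u^{5/8}$ of the chosen sides, where $C_0$ is an absolute constant (such a choice is known to exist). $\ell^\rho_{i,z}$ denotes the $\delta$-neighborhood of $l^\rho_{i,z}$. The operator $\widetilde{M}_{\rho,\delta}$ is defined for locally integrable $f$ and $x\in Q_z$ by $$\widetilde{M}_{\rho,\delta}f(x)=\frac{1}{|\ell_{x,\delta}|}\int_{\ell_{x,\delta}}f(y)\,dy,$$ where $\ell_{x,\delta}$ is the $\delta$-neighborhood of the chosen side of $S(x^*,\rho(x^* ))$, i.e. $\ell_{x,\delta}=\ell^\rho_{i,z}$ when $x\in Q_z(i)$. Finally $$[w]_{A^S_{1,\rho,z}}=\max_{1\le i\le u}\left(\frac{1}{|\ell^\rho_{i,z}|}\int_{Q_z(i)}w\right)\|w^{-1}\|_{L^\infty(\ell^\rho_{i,z})}.$$ *)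

theory Defs
  imports "HOL-Analysis.Analysis" "HOL-Probability.Essential_Supremum"
begin

definition locally_integrable :: "(real^2 \<Rightarrow> 'b::euclidean_space) \<Rightarrow> bool" where
  "locally_integrable f \<longleftrightarrow> (\<forall>K. compact K \<longrightarrow> f absolutely_integrable_on K)"

definition weight :: "(real^2 \<Rightarrow> real) \<Rightarrow> bool" where
  "weight w \<longleftrightarrow> (\<forall>x. 0 \<le> w x) \<and> locally_integrable w"

definition L1_norm :: "(real^2) set \<Rightarrow> (real^2 \<Rightarrow> real) \<Rightarrow> (real^2 \<Rightarrow> complex) \<Rightarrow> ennreal" where
  "L1_norm E w f = (\<integral>\<^sup>+x\<in>E. ennreal (norm (f x) * w x) \<partial>lebesgue)"

text \<open>Axis-parallel square with centre \<open>c\<close> and sidelength \<open>s\<close>. Squares are taken half-open, so that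
  the small squares partition the large one exactly.\<close>
definition square :: "real^2 \<Rightarrow> real \<Rightarrow> (real^2) set" where
  "square c s = {x. \<forall>j. c $ j - s / 2 \<le> x $ j \<and> x $ j < c $ j + s / 2}"

text \<open>\<open>C Q\<^sub>z\<close>, where \<open>Q\<^sub>z\<close> is the unit square with lower left vertex \<open>z\<close>.\<close>
definition dilated_Q :: "real \<Rightarrow> int^2 \<Rightarrow> (real^2) set" where
  "dilated_Q C z = square (\<chi> j. of_int (z $ j) + 1 / 2) C"

abbreviation Q :: "int^2 \<Rightarrow> (real^2) set" where
  "Q z \<equiv> dilated_Q 1 z"

text \<open>The centres of the squares of the grid \<open>\<delta>\<int>\<^sup>2\<close> that make up \<open>Q\<^sub>z\<close> (when \<open>1/\<delta>\<close> is an integer).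
  The squares \<open>Q\<^sub>z(i)\<close>, and all families indexed by \<open>i = 1,\<dots>,u\<close>, are indexed by
  their centres: \<open>Q\<^sub>z(i) = square x\<^sub>i \<delta>\<close>.\<close>
definition Q_star :: "real \<Rightarrow> int^2 \<Rightarrow> (real^2) set" where
  "Q_star \<delta> z = {c \<in> Q z. \<exists>k::int^2. \<forall>j. c $ j = \<delta> * (of_int (k $ j) + 1 / 2)}"

definition star :: "real \<Rightarrow> int^2 \<Rightarrow> real^2 \<Rightarrow> real^2" where
  "star \<delta> z x = (THE c. c \<in> Q_star \<delta> z \<and> x \<in> square c \<delta>)"

definition Gamma_family :: "real \<Rightarrow> int^2 \<Rightarrow> (real^2 \<Rightarrow> real) set" where
  "Gamma_family \<delta> z = Q_star \<delta> z \<rightarrow>\<^sub>E {1..2} \<inter> range (\<lambda>n::int. \<delta> * of_int n)"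

definition skeleton :: "real^2 \<Rightarrow> real \<Rightarrow> (real^2) set" where
  "skeleton x r = frontier (cbox (x - (\<chi> j. r)) (x + (\<chi> j. r)))"

definition sides :: "real^2 \<Rightarrow> real \<Rightarrow> (real^2) set set" where
  "sides x r = {{y \<in> skeleton x r. y $ j = x $ j + s * r} | j s. s \<in> {-1, 1}}"

definition axis_line :: "2 \<Rightarrow> real \<Rightarrow> (real^2) set" where
  "axis_line j a = {y. y $ j = a}"

text \<open>\<open>\<Phi> z \<rho> x\<^sub>i\<close> is the chosen side of \<open>S(x\<^sub>i, \<rho>(x\<^sub>i))\<close>. Distinct centres in \<open>Q\<^sub>z\<close> have distinct
  chosen sides (the radii are at least 1), so counting centres counts sides.\<close>
type_synonym selection = "int^2 \<Rightarrow> (real^2 \<Rightarrow> real) \<Rightarrow> real^2 \<Rightarrow> (real^2) set"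

definition side_selection :: "real \<Rightarrow> real \<Rightarrow> selection \<Rightarrow> bool" where
  "side_selection C0 \<delta> \<Phi> \<longleftrightarrow>
     (\<forall>z. \<forall>\<rho>\<in>Gamma_family \<delta> z.
        (\<forall>c\<in>Q_star \<delta> z. \<Phi> z \<rho> c \<in> sides c (\<rho> c)) \<and>
        (\<forall>j a. real (card {c \<in> Q_star \<delta> z. \<Phi> z \<rho> c \<subseteq> axis_line j a})
                 \<le> C0 * (1 / \<delta>\<^sup>2) powr (5 / 8)))"

definition nbhd :: "real \<Rightarrow> (real^2) set \<Rightarrow> (real^2) set" where
  "nbhd \<delta> A = {y. \<exists>x\<in>A. dist x y < \<delta>}"

definition M_tilde ::
  "real \<Rightarrow> selection \<Rightarrow> int^2 \<Rightarrow> (real^2 \<Rightarrow> real) \<Rightarrow> (real^2 \<Rightarrow> complex) \<Rightarrow> real^2 \<Rightarrow> complex" where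
  "M_tilde \<delta> \<Phi> z \<rho> f x =
     (let l = nbhd \<delta> (\<Phi> z \<rho> (star \<delta> z x))
      in (1 / measure lebesgue l) *\<^sub>R (LINT y:l|lebesgue. f y))"

definition A1_const ::
  "real \<Rightarrow> selection \<Rightarrow> int^2 \<Rightarrow> (real^2 \<Rightarrow> real) \<Rightarrow> (real^2 \<Rightarrow> real) \<Rightarrow> ennreal" where
  "A1_const \<delta> \<Phi> z \<rho> w =
     Max ((\<lambda>c. let l = nbhd \<delta> (\<Phi> z \<rho> c) in
             (1 / emeasure lebesgue l * (\<integral>\<^sup>+x\<in>square c \<delta>. ennreal (w x) \<partial>lebesgue))
             * esssup (restrict_space lebesgue l) (\<lambda>x. inverse (ennreal (w x))))
          ` Q_star \<delta> z)"

end

theory Submission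
  imports Defs
begin

text \<open>Averaging \<open>f\<close> over a chosen neighbourhood \<open>l\<close> and inserting \<open>1 \<le> \<parallel>w\<^sup>-\<^sup>1\<parallel>\<^sub>\<infinity> w\<close> on \<open>l\<close> bounds the
  contribution of one small square by the \<open>A\<^sub>1\<close> constant times \<open>\<integral>\<^sub>l |f| w\<close>. Summing over the small
  squares leaves the overlap of the neighbourhoods to be estimated: all chosen sides lie on lines whose
  coordinate belongs to \<open>\<delta>(\<int> + 1/2)\<close>, so at a given point only four such lines can be within
  distance \<open>\<delta>\<close>, and each of them carries at most \<open>C\<^sub>0 u\<^sup>5\<^sup>/\<^sup>8\<close> sides.\<close>

section \<open>Averages over a set, weighted by \<open>w\<close>\<close>

text \<open>No integrability is assumed: the integral of a non-integrable function is 0 by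
  convention, and the bound is then trivial.\<close>

lemma norm_set_lebesgue_integral_le_nn_integral:
  fixes f :: "'a \<Rightarrow> 'b::{banach, second_countable_topology}"
  shows "ennreal (norm (LINT y:l|M. f y)) \<le> (\<integral>\<^sup>+y\<in>l. ennreal (norm (f y)) \<partial>M)"
proof (cases "set_integrable M l f")
  case True
  then have "ennreal (norm (LINT y:l|M. f y)) \<le> (\<integral>\<^sup>+y. ennreal (norm (indicator l y *\<^sub>R f y)) \<partial>M)"
    unfolding set_lebesgue_integral_def set_integrable_def by (rule integral_norm_bound_ennreal)
  also have "\<dots> = (\<integral>\<^sup>+y\<in>l. ennreal (norm (f y)) \<partial>M)"
    by (intro nn_integral_cong) (simp split: split_indicator)
  finally show ?thesis .
next
  case False
  then show ?thesis
    by (simp add: set_lebesgue_integral_def set_integrable_def not_integrable_integral_eq)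
qed

text \<open>If \<open>l\<close> has measure \<open>0\<close> or \<open>\<infinity>\<close>, then \<open>1 / measure M l\<close> is \<open>1 / 0 = 0\<close>.\<close>
lemma ennreal_inverse_measure_le: "ennreal (1 / measure M l) \<le> 1 / emeasure M l"
proof (cases "measure M l = 0")
  case False
  then have "emeasure M l \<noteq> top" by (auto simp: measure_def)
  then have "emeasure M l = ennreal (measure M l)" by (rule emeasure_eq_ennreal_measure)
  moreover have "0 < measure M l" using False by (simp add: less_le)
  ultimately show ?thesis
    using divide_ennreal[of 1 "measure M l"] by simp
qed simp

text \<open>The average is a constant on \<open>S\<close>, so the left side is its norm times the
  \<open>w\<close>-mass of \<open>S\<close>. That mass over the measure of \<open>l\<close> is the
  first factor of \<open>B\<close>; the second factor pays for putting \<open>w\<close> under the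
  integral over \<open>l\<close>.\<close>

lemma nn_integral_average_times_weight_le:
  fixes f :: "'a \<Rightarrow> 'b::{banach, second_countable_topology}" and w :: "'a \<Rightarrow> real"
  assumes [measurable]: "f \<in> borel_measurable M" "w \<in> borel_measurable M" "l \<in> sets M" "S \<in> sets M"
    and w: "\<And>x. 0 \<le> w x"
    and B: "B = (1 / emeasure M l * (\<integral>\<^sup>+x\<in>S. ennreal (w x) \<partial>M))
                 * esssup (restrict_space M l) (\<lambda>x. inverse (ennreal (w x)))"
    and fin: "B < \<infinity>"
  shows "(\<integral>\<^sup>+x\<in>S. ennreal (norm ((1 / measure M l) *\<^sub>R (LINT y:l|M. f y)) * w x) \<partial>M)
           \<le> B * (\<integral>\<^sup>+y\<in>l. ennreal (norm (f y) * w y) \<partial>M)"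
proof -
  define K where "K = (1 / measure M l) *\<^sub>R (LINT y:l|M. f y)"
  define W where "W = (\<integral>\<^sup>+x\<in>S. ennreal (w x) \<partial>M)"
  define avg where "avg = 1 / emeasure M l * W"
  define E where "E = esssup (restrict_space M l) (\<lambda>x. inverse (ennreal (w x)))"
  have B': "B = avg * E" using B by (simp add: avg_def W_def E_def)
  have "AE x in restrict_space M l. inverse (ennreal (w x)) \<le> E"
    unfolding E_def by (rule esssup_AE)
  then have AE_E: "AE x in M. x \<in> l \<longrightarrow> inverse (ennreal (w x)) \<le> E"
    by (simp add: AE_restrict_space_iff)
  have AE_avg: "AE x in M. x \<in> l \<longrightarrow> avg \<le> B * ennreal (w x)"
  \<comment> \<open>Finiteness of \<open>B\<close> bounds \<open>E\<close> only when
    \<open>avg\<close> is nonzero, since 0 times infinity is 0. For \<open>avg = 0\<close> the claim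
    is trivial.\<close>
  proof (cases "avg = 0")
    case False
    then have E: "E \<noteq> \<infinity>"
      using fin B' by (auto simp: ennreal_mult_top)
    show ?thesis
      using AE_E
    proof (eventually_elim, intro impI)
      fix x assume "x \<in> l \<longrightarrow> inverse (ennreal (w x)) \<le> E" "x \<in> l"
      then have le: "inverse (ennreal (w x)) \<le> E" by simp
      \<comment> \<open>In \<open>ennreal\<close> the inverse of 0 is \<open>top\<close>, so a zero
        of \<open>w\<close> here would contradict the finiteness of \<open>E\<close>.\<close>
      then have pos: "0 < w x"
        using E w[of x] by (cases "w x = 0") (auto simp: top_unique)
      then have "1 = inverse (ennreal (w x)) * ennreal (w x)"
        by (simp add: inverse_ennreal flip: ennreal_mult' ennreal_1)
      also have "\<dots> \<le> E * ennreal (w x)"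
        by (intro mult_right_mono le) simp
      finally have "avg * 1 \<le> avg * (E * ennreal (w x))"
        by (intro mult_left_mono) simp_all
      then show "avg \<le> B * ennreal (w x)" by (simp add: B' mult.assoc)
    qed
  qed simp
  have "(\<integral>\<^sup>+x\<in>S. ennreal (norm K * w x) \<partial>M)
      = (\<integral>\<^sup>+x. ennreal (norm K) * (ennreal (w x) * indicator S x) \<partial>M)"
    by (intro nn_integral_cong) (simp add: ennreal_mult' mult.assoc)
  also have "\<dots> = ennreal (norm K) * W"
    unfolding W_def by (rule nn_integral_cmult) measurable
  also have "\<dots> = ennreal (1 / measure M l) * ennreal (norm (LINT y:l|M. f y)) * W"
    by (simp add: K_def ennreal_mult' divide_inverse)
  also have "\<dots> \<le> 1 / emeasure M l * (\<integral>\<^sup>+y\<in>l. ennreal (norm (f y)) \<partial>M) * W"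
    by (intro mult_right_mono mult_mono ennreal_inverse_measure_le
        norm_set_lebesgue_integral_le_nn_integral) simp_all
  also have "\<dots> = avg * (\<integral>\<^sup>+y\<in>l. ennreal (norm (f y)) \<partial>M)"
    by (simp add: avg_def mult_ac)
  also have "\<dots> = (\<integral>\<^sup>+y. avg * (ennreal (norm (f y)) * indicator l y) \<partial>M)"
    by (rule nn_integral_cmult[symmetric]) measurable
  also have "\<dots> \<le> (\<integral>\<^sup>+y. B * (ennreal (norm (f y) * w y) * indicator l y) \<partial>M)"
  proof (rule nn_integral_mono_AE, use AE_avg in eventually_elim)
    fix y assume *: "y \<in> l \<longrightarrow> avg \<le> B * ennreal (w y)"
    show "avg * (ennreal (norm (f y)) * indicator l y)
        \<le> B * (ennreal (norm (f y) * w y) * indicator l y)"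
    proof (cases "y \<in> l")
      case True
      then have "avg * ennreal (norm (f y)) \<le> B * ennreal (w y) * ennreal (norm (f y))"
        using * by (intro mult_right_mono) simp_all
      then show ?thesis using True w[of y] by (simp add: ennreal_mult mult_ac)
    qed simp
  qed
  also have "\<dots> = B * (\<integral>\<^sup>+y\<in>l. ennreal (norm (f y) * w y) \<partial>M)"
    by (rule nn_integral_cmult) measurable
  finally show ?thesis unfolding K_def .
qed

text \<open>The truncations to balls of integer radius are integrable, hence measurable, and
  converge pointwise because they are eventually constant at each point.\<close>

lemma locally_integrable_imp_borel_measurable:
  assumes "locally_integrable f"
  shows "f \<in> borel_measurable lebesgue"
proof (rule borel_measurable_LIMSEQ_metric)
  fix n :: nat
  have "f absolutely_integrable_on (cball 0 (real n))"
    using assms by (simp add: locally_integrable_def)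
  then show "(\<lambda>x. indicator (cball 0 (real n)) x *\<^sub>R f x) \<in> borel_measurable lebesgue"
    by (simp add: set_integrable_def borel_measurable_integrable)
next
  fix x :: "real^2"
  obtain N :: nat where N: "norm x \<le> real N" using real_arch_simple by blast
  have "eventually (\<lambda>n. indicator (cball 0 (real n)) x *\<^sub>R f x = f x) sequentially"
    using eventually_ge_at_top[of N]
  proof eventually_elim
    case (elim n)
    then have "norm x \<le> real n" using N by linarith
    then show ?case by simp
  qed
  then show "(\<lambda>n. indicator (cball 0 (real n)) x *\<^sub>R f x) \<longlonglongrightarrow> f x"
    by (rule tendsto_eventually)
qed

section \<open>Measurability of the sets and geometry of the grid\<close>

lemma square_in_sets_lebesgue [measurable]: "square c s \<in> sets lebesgue"
proof -
  have "square c s = (\<Inter>j. {x. c $ j - s / 2 \<le> x $ j} \<inter> {x. x $ j < c $ j + s / 2})"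
    by (auto simp: square_def)
  moreover have "\<dots> \<in> sets borel"
    by (intro sets.finite_INT sets.Int borel_closed borel_open closed_Collect_le open_Collect_less
        continuous_intros) auto
  ultimately show ?thesis by simp
qed

lemma nbhd_in_sets_lebesgue [measurable]: "nbhd \<delta> A \<in> sets lebesgue"
proof -
  have "nbhd \<delta> A = (\<Union>x\<in>A. ball x \<delta>)" by (auto simp: nbhd_def)
  then have "open (nbhd \<delta> A)" by auto
  then show ?thesis by simp
qed

lemma mem_Q: "x \<in> Q z \<longleftrightarrow> (\<forall>j. of_int (z $ j) \<le> x $ j \<and> x $ j < of_int (z $ j) + 1)"
  by (simp add: dilated_Q_def square_def add.commute)

text \<open>A centre is determined by two integer indices, each confined to a bounded range. The
  range \<open>I\<close> is deliberately generous.\<close>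

lemma finite_Q_star:
  assumes "0 < \<delta>"
  shows "finite (Q_star \<delta> z)"
proof -
  define g :: "int \<times> int \<Rightarrow> real^2" where
    "g = (\<lambda>(a, b). vector [\<delta> * (of_int a + 1 / 2), \<delta> * (of_int b + 1 / 2)])"
  define I where "I = (\<lambda>j. {\<lfloor>of_int (z $ j) / \<delta>\<rfloor> - 1 .. \<lceil>(of_int (z $ j) + 1) / \<delta>\<rceil>})"
  have "Q_star \<delta> z \<subseteq> g ` (I 1 \<times> I 2)"
  proof
    fix c assume c: "c \<in> Q_star \<delta> z"
    then obtain k :: "int^2" where k: "\<And>j. c $ j = \<delta> * (of_int (k $ j) + 1 / 2)"
      by (auto simp: Q_star_def)
    have "k $ j \<in> I j" for j
    proof -
      have "of_int (z $ j) \<le> \<delta> * (of_int (k $ j) + 1 / 2)"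
        and "\<delta> * (of_int (k $ j) + 1 / 2) < of_int (z $ j) + 1"
        using c by (simp_all add: Q_star_def mem_Q flip: k)
      then have "of_int (z $ j) / \<delta> \<le> of_int (k $ j) + 1 / 2"
        and "of_int (k $ j) + 1 / 2 < (of_int (z $ j) + 1) / \<delta>"
        using assms by (simp_all add: field_simps)
      then show ?thesis unfolding I_def by simp linarith
    qed
    moreover have "c = g (k $ 1, k $ 2)"
      by (simp add: g_def vec_eq_iff forall_2 k)
    ultimately show "c \<in> g ` (I 1 \<times> I 2)" by blast
  qed
  then show ?thesis by (rule finite_subset) (simp add: I_def)
qed

text \<open>The cell has index \<open>\<lfloor>x $ j / \<delta>\<rfloor>\<close> in direction
  \<open>j\<close>. Since \<open>1 / \<delta>\<close> is an integer, the sides of \<open>Q z\<close>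
  lie on grid lines, so this cell cannot stick out of \<open>Q z\<close> and its centre belongs to
  \<open>Q_star\<close>.\<close>

lemma Q_star_square_exists:
  assumes \<delta>: "0 < \<delta>" "1 / \<delta> \<in> \<nat>" and x: "x \<in> Q z"
  shows "\<exists>c \<in> Q_star \<delta> z. x \<in> square c \<delta>"
proof -
  obtain N :: nat where "1 / \<delta> = real N" using \<delta>(2) by (auto elim: Nats_cases)
  then have N: "\<delta> * real N = 1" using \<delta>(1) by (simp add: field_simps)
  define k where "k = (\<lambda>j. \<lfloor>x $ j / \<delta>\<rfloor>)"
  define c :: "real^2" where "c = (\<chi> j. \<delta> * (of_int (k j) + 1 / 2))"
  have k: "\<delta> * of_int (k j) \<le> x $ j" "x $ j < \<delta> * of_int (k j) + \<delta>" for j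
  proof -
    have "of_int (k j) \<le> x $ j / \<delta>" "x $ j / \<delta> < of_int (k j) + 1"
      unfolding k_def by linarith+
    then show "\<delta> * of_int (k j) \<le> x $ j" "x $ j < \<delta> * of_int (k j) + \<delta>"
      using \<delta>(1) by (simp_all add: field_simps)
  qed
  have "x \<in> square c \<delta>"
    using k by (auto simp: square_def c_def algebra_simps)
  moreover have "of_int (z $ j) \<le> c $ j \<and> c $ j < of_int (z $ j) + 1" for j
  proof -
    have xj: "of_int (z $ j) \<le> x $ j" "x $ j < of_int (z $ j) + 1"
      using x by (simp_all add: mem_Q)
    \<comment> \<open>Writing integers as grid coordinates turns the position of \<open>x\<close> in
      \<open>Q z\<close> into strict inequalities between integers, which improve by one to place
      the whole cell inside.\<close>
    have grid: "\<delta> * of_int (m * int N) = of_int m" for m :: int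
      using N by (simp add: mult_ac)
    have "\<delta> * of_int (z $ j * int N) < \<delta> * of_int (k j + 1)"
      unfolding grid using k(2)[of j] xj(1) by (simp add: algebra_simps)
    then have "(of_int (z $ j * int N) :: real) < of_int (k j + 1)"
      using \<delta>(1) by (simp only: mult_less_cancel_left_pos)
    then have "z $ j * int N \<le> k j" by linarith
    then have "\<delta> * of_int (z $ j * int N) \<le> \<delta> * of_int (k j)"
      using \<delta>(1) by (simp only: mult_le_cancel_left_pos of_int_le_iff)
    moreover have "\<delta> * of_int (k j) < \<delta> * of_int ((z $ j + 1) * int N)"
      unfolding grid using k(1)[of j] xj(2) by simp
    then have "(of_int (k j) :: real) < of_int ((z $ j + 1) * int N)"
      using \<delta>(1) by (simp only: mult_less_cancel_left_pos)
    then have "k j + 1 \<le> (z $ j + 1) * int N" by linarith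
    then have "\<delta> * of_int (k j + 1) \<le> \<delta> * of_int ((z $ j + 1) * int N)"
      using \<delta>(1) by (simp only: mult_le_cancel_left_pos of_int_le_iff)
    ultimately show ?thesis
      unfolding grid using \<delta>(1) by (simp add: c_def algebra_simps)
  qed
  then have "c \<in> Q_star \<delta> z"
    by (auto simp: Q_star_def mem_Q c_def intro!: exI[of _ "\<chi> j. k j"])
  ultimately show ?thesis by blast
qed

text \<open>For half-open cells with a common point, each index is less than the other plus one, so
  the integer indices agree.\<close>

lemma Q_star_square_unique:
  assumes \<delta>: "0 < \<delta>" and "c \<in> Q_star \<delta> z" "c' \<in> Q_star \<delta> z"
    and x: "x \<in> square c \<delta>" "x \<in> square c' \<delta>"
  shows "c = c'"
proof -
  obtain k k' :: "int^2" where k: "\<And>j. c $ j = \<delta> * (of_int (k $ j) + 1 / 2)"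
    and k': "\<And>j. c' $ j = \<delta> * (of_int (k' $ j) + 1 / 2)"
    using assms by (auto simp: Q_star_def)
  have "k $ j = k' $ j" for j
  proof -
    have "c $ j - \<delta> / 2 \<le> x $ j" "x $ j < c $ j + \<delta> / 2"
      "c' $ j - \<delta> / 2 \<le> x $ j" "x $ j < c' $ j + \<delta> / 2"
      using x by (simp_all add: square_def)
    then have *: "\<delta> * of_int (k $ j) \<le> x $ j" "x $ j < \<delta> * of_int (k $ j + 1)"
      "\<delta> * of_int (k' $ j) \<le> x $ j" "x $ j < \<delta> * of_int (k' $ j + 1)"
      by (simp_all add: k k' algebra_simps)
    have "\<delta> * of_int (k $ j) < \<delta> * of_int (k' $ j + 1)"
      "\<delta> * of_int (k' $ j) < \<delta> * of_int (k $ j + 1)"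
      using * by linarith+
    then have "k $ j < k' $ j + 1" "k' $ j < k $ j + 1"
      using \<delta> by (simp_all only: mult_less_cancel_left_pos of_int_less_iff)
    then show ?thesis by simp
  qed
  then show ?thesis by (simp add: vec_eq_iff k k')
qed

lemma star_properties:
  assumes "0 < \<delta>" "1 / \<delta> \<in> \<nat>" "x \<in> Q z"
  shows "star \<delta> z x \<in> Q_star \<delta> z \<and> x \<in> square (star \<delta> z x) \<delta>"
  unfolding star_def
  by (rule theI') (use Q_star_square_exists[OF assms] Q_star_square_unique[OF assms(1)] in blast)

section \<open>Position of the sides and overlap of their neighbourhoods\<close>

lemma skeleton_component_le:
  assumes "x \<in> skeleton c r"
  shows "\<bar>x $ j - c $ j\<bar> \<le> r"
proof -
  have "x \<in> cbox (c - (\<chi> j. r)) (c + (\<chi> j. r))"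
    using assms frontier_subset_closed[OF closed_cbox] unfolding skeleton_def by blast
  then have "c $ j - r \<le> x $ j" "x $ j \<le> c $ j + r"
    by (auto simp: mem_box_cart)
  then show ?thesis by linarith
qed

text \<open>The source of the factor 7: in each coordinate a point of the neighbourhood is less than
  2 + 1 away from a centre in the unit square, so 3 is added at both ends.\<close>

lemma nbhd_side_subset_dilated_Q:
  assumes "\<delta> < 1" "c \<in> Q_star \<delta> z" "r \<le> 2" "A \<in> sides c r"
  shows "nbhd \<delta> A \<subseteq> dilated_Q 7 z"
proof
  fix y assume "y \<in> nbhd \<delta> A"
  then obtain x where x: "x \<in> A" "dist x y < \<delta>" by (auto simp: nbhd_def)
  have "x \<in> skeleton c r" using x(1) assms(4) by (auto simp: sides_def)
  then have 1: "\<bar>x $ j - c $ j\<bar> \<le> 2" for j using skeleton_component_le assms(3) order_trans by blast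
  have 2: "\<bar>x $ j - y $ j\<bar> < 1" for j
    using dist_vec_nth_le[of x j y] x(2) assms(1) by (simp add: dist_real_def)
  have 3: "of_int (z $ j) \<le> c $ j" "c $ j < of_int (z $ j) + 1" for j
    using assms(2) by (simp_all add: Q_star_def mem_Q)
  have "of_int (z $ j) - 3 \<le> y $ j \<and> y $ j < of_int (z $ j) + 4" for j
    using 1[of j] 2[of j] 3[of j] by linarith
  then show "y \<in> dilated_Q 7 z"
    by (auto simp: dilated_Q_def square_def algebra_simps)
qed

text \<open>Centres have coordinates in \<delta>(\<int> + 1/2) and radii lie in \<delta>\<int>, so
  the line through a side has coordinate \<delta>(m + 1/2) for an integer m. Being within \<delta>
  of \<open>y\<close> leaves two values of m per direction.\<close>

lemma side_near_point_in_grid_line: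
  assumes \<delta>: "0 < \<delta>" and c: "c \<in> Q_star \<delta> z" and r: "r = \<delta> * of_int n"
    and A: "A \<in> sides c r" and y: "y \<in> nbhd \<delta> A"
  shows "\<exists>j. \<exists>e\<in>{0, 1}. A \<subseteq> axis_line j (\<delta> * (of_int (\<lfloor>y $ j / \<delta> - 1 / 2\<rfloor> + e) + 1 / 2))"
proof -
  obtain k :: "int^2" where k: "\<And>j. c $ j = \<delta> * (of_int (k $ j) + 1 / 2)"
    using c by (auto simp: Q_star_def)
  obtain j and s :: real where s: "s \<in> {-1, 1}"
    and A_eq: "A = {y \<in> skeleton c r. y $ j = c $ j + s * r}"
    using A by (auto simp: sides_def)
  obtain m where m: "c $ j + s * r = \<delta> * (of_int m + 1 / 2)"
  proof
    show "c $ j + s * r = \<delta> * (of_int (if s = 1 then k $ j + n else k $ j - n) + 1 / 2)"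
      using s by (auto simp: k r algebra_simps)
  qed
  obtain x where x: "x \<in> A" "dist x y < \<delta>" using y by (auto simp: nbhd_def)
  have "\<bar>\<delta> * (of_int m + 1 / 2) - y $ j\<bar> < \<delta>"
    using x dist_vec_nth_le[of x j y] by (auto simp: dist_real_def A_eq m)
  then have "\<delta> * (of_int m - 1 / 2) < y $ j" "y $ j < \<delta> * (of_int m + 3 / 2)"
    by (simp_all add: algebra_simps abs_less_iff)
  then have "of_int m - 1 / 2 < y $ j / \<delta>" "y $ j / \<delta> < of_int m + 3 / 2"
    using \<delta> by (simp_all add: field_simps)
  \<comment> \<open>The number under the floor lies in the open interval from m - 1 to m + 1, so its
    floor is m - 1 or m.\<close>
  then have "m = \<lfloor>y $ j / \<delta> - 1 / 2\<rfloor> + 0 \<or> m = \<lfloor>y $ j / \<delta> - 1 / 2\<rfloor> + 1" by linarith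
  moreover have "A \<subseteq> axis_line j (\<delta> * (of_int m + 1 / 2))"
    by (auto simp: A_eq m axis_line_def)
  ultimately show ?thesis by (metis insertCI)
qed

lemma nbhd_overlap_le:
  assumes \<delta>: "0 < \<delta>" and sel: "side_selection C0 \<delta> \<Phi>" and \<rho>: "\<rho> \<in> Gamma_family \<delta> z"
  shows "real (card {c \<in> Q_star \<delta> z. y \<in> nbhd \<delta> (\<Phi> z \<rho> c)}) \<le> 4 * C0 * \<delta> powr (- 5 / 4)"
proof -
  define L where "L = (\<lambda>(j, e). {c \<in> Q_star \<delta> z. \<Phi> z \<rho> c \<subseteq>
    axis_line j (\<delta> * (of_int (\<lfloor>y $ j / \<delta> - 1 / 2\<rfloor> + e) + 1 / 2))})"
  \<comment> \<open>\<open>P\<close> indexes the candidate lines near \<open>y\<close>: two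
    directions times two coordinates, whence the factor 4.\<close>
  define P where "P = (UNIV :: 2 set) \<times> {0, 1 :: int}"
  have cardL: "real (card (L p)) \<le> C0 * (1 / \<delta>\<^sup>2) powr (5 / 8)" for p
    using sel \<rho> by (auto simp: side_selection_def L_def split: prod.split)
  have fin: "finite (L p)" for p
    by (rule finite_subset[OF _ finite_Q_star[OF \<delta>, of z]]) (auto simp: L_def split: prod.split)
  have sub: "{c \<in> Q_star \<delta> z. y \<in> nbhd \<delta> (\<Phi> z \<rho> c)} \<subseteq> (\<Union>p\<in>P. L p)"
  proof
    fix c assume "c \<in> {c \<in> Q_star \<delta> z. y \<in> nbhd \<delta> (\<Phi> z \<rho> c)}"
    then have c: "c \<in> Q_star \<delta> z" "y \<in> nbhd \<delta> (\<Phi> z \<rho> c)" by auto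
    obtain n :: int where "\<rho> c = \<delta> * of_int n"
      using PiE_mem[OF \<rho>[unfolded Gamma_family_def] c(1)] by auto
    moreover have "\<Phi> z \<rho> c \<in> sides c (\<rho> c)"
      using sel \<rho> c(1) by (auto simp: side_selection_def)
    ultimately obtain j e where "e \<in> {0, 1}"
      "\<Phi> z \<rho> c \<subseteq> axis_line j (\<delta> * (of_int (\<lfloor>y $ j / \<delta> - 1 / 2\<rfloor> + e) + 1 / 2))"
      using side_near_point_in_grid_line[OF \<delta> c(1) _ _ c(2)] by blast
    then have "c \<in> L (j, e)" "(j, e) \<in> P" using c(1) by (auto simp: L_def P_def)
    then show "c \<in> (\<Union>p\<in>P. L p)" by blast
  qed
  have "card {c \<in> Q_star \<delta> z. y \<in> nbhd \<delta> (\<Phi> z \<rho> c)} \<le> card (\<Union>p\<in>P. L p)"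
    by (rule card_mono[OF _ sub]) (simp add: P_def fin)
  also have "\<dots> \<le> (\<Sum>p\<in>P. card (L p))"
    by (rule card_UN_le) (simp add: P_def)
  finally have "real (card {c \<in> Q_star \<delta> z. y \<in> nbhd \<delta> (\<Phi> z \<rho> c)}) \<le> (\<Sum>p\<in>P. real (card (L p)))"
    by (simp flip: of_nat_sum)
  also have "\<dots> \<le> real (card P) * (C0 * (1 / \<delta>\<^sup>2) powr (5 / 8))"
    by (rule sum_bounded_above) (rule cardL)
  \<comment> \<open>The exponent of the theorem arises here, as -2 times 5/8.\<close>
  also have "1 / \<delta>\<^sup>2 = \<delta> powr (- 2)"
    using \<delta> by (simp add: powr_minus_divide)
  also have "real (card P) * (C0 * (\<delta> powr (- 2)) powr (5 / 8)) = 4 * C0 * \<delta> powr (- 5 / 4)"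
    by (simp add: P_def card_cartesian_product powr_powr)
  finally show ?thesis .
qed

text \<open>The overlap count in the form needed under an integral in
  \<open>ennreal\<close>.\<close>

lemma sum_indicator_nbhd_le:
  assumes "0 < \<delta>" "side_selection C0 \<delta> \<Phi>" "\<rho> \<in> Gamma_family \<delta> z"
  shows "(\<Sum>c\<in>Q_star \<delta> z. indicator (nbhd \<delta> (\<Phi> z \<rho> c)) y) \<le> ennreal (4 * C0 * \<delta> powr (- 5 / 4))"
proof -
  have "(\<Sum>c\<in>Q_star \<delta> z. indicator (nbhd \<delta> (\<Phi> z \<rho> c)) y :: ennreal)
      = (\<Sum>c\<in>Q_star \<delta> z. if y \<in> nbhd \<delta> (\<Phi> z \<rho> c) then 1 else 0)"
    by (intro sum.cong) auto
  also have "\<dots> = of_nat (card {c \<in> Q_star \<delta> z. y \<in> nbhd \<delta> (\<Phi> z \<rho> c)})"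
    using finite_Q_star[OF assms(1)] by (simp add: sum.If_cases Int_def)
  also have "\<dots> = ennreal (real (card {c \<in> Q_star \<delta> z. y \<in> nbhd \<delta> (\<Phi> z \<rho> c)}))"
    by (simp add: ennreal_of_nat_eq_real_of_nat)
  also have "\<dots> \<le> ennreal (4 * C0 * \<delta> powr (- 5 / 4))"
    by (intro ennreal_leI nbhd_overlap_le assms)
  finally show ?thesis .
qed

section \<open>Summation over the small squares\<close>

lemma L1_norm_M_tilde_le:
  assumes \<delta>: "0 < \<delta>" "\<delta> < 1" "1 / \<delta> \<in> \<nat>"
    and sel: "side_selection C0 \<delta> \<Phi>" and \<rho>: "\<rho> \<in> Gamma_family \<delta> z"
    and w: "weight w" and A_fin: "A1_const \<delta> \<Phi> z \<rho> w < \<infinity>" and f: "locally_integrable f"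
  shows "L1_norm (Q z) w (M_tilde \<delta> \<Phi> z \<rho> f)
    \<le> ennreal (4 * C0 * \<delta> powr (- 5 / 4)) * A1_const \<delta> \<Phi> z \<rho> w * L1_norm (dilated_Q 7 z) w f"
proof -
  define A where "A = A1_const \<delta> \<Phi> z \<rho> w"
  define D where "D = ennreal (4 * C0 * \<delta> powr (- 5 / 4))"
  define l where "l = (\<lambda>c. nbhd \<delta> (\<Phi> z \<rho> c))"
  \<comment> \<open>\<open>K c\<close> is the constant value of \<open>M_tilde\<close> on the part
    of \<open>Q z\<close> in the cell with centre \<open>c\<close>.\<close>
  define K where "K = (\<lambda>c. (1 / measure lebesgue (l c)) *\<^sub>R (LINT y:l c|lebesgue. f y))"
  note fin = finite_Q_star[OF \<delta>(1), of z]
  have [measurable]: "f \<in> borel_measurable lebesgue" "w \<in> borel_measurable lebesgue"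
    using f w by (auto intro: locally_integrable_imp_borel_measurable simp: weight_def)
  have w0: "0 \<le> w x" for x using w by (simp add: weight_def)
  have [measurable]: "l c \<in> sets lebesgue" "dilated_Q 7 z \<in> sets lebesgue" for c
    by (simp_all add: l_def dilated_Q_def square_in_sets_lebesgue nbhd_in_sets_lebesgue)
  have piece: "(\<integral>\<^sup>+x\<in>square c \<delta>. ennreal (norm (K c) * w x) \<partial>lebesgue)
      \<le> A * (\<integral>\<^sup>+y\<in>l c. ennreal (norm (f y) * w y) \<partial>lebesgue)" if c: "c \<in> Q_star \<delta> z" for c
  proof -
    define B where "B = (1 / emeasure lebesgue (l c) * (\<integral>\<^sup>+x\<in>square c \<delta>. ennreal (w x) \<partial>lebesgue))
                 * esssup (restrict_space lebesgue (l c)) (\<lambda>x. inverse (ennreal (w x)))"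
    \<comment> \<open>\<open>A\<close> is a maximum over the finite set of centres, and
      \<open>B\<close> is the entry at \<open>c\<close>.\<close>
    have BA: "B \<le> A"
      unfolding A_def A1_const_def B_def l_def Let_def
      by (rule Max_ge) (use fin c in auto)
    have "(\<integral>\<^sup>+x\<in>square c \<delta>. ennreal (norm (K c) * w x) \<partial>lebesgue)
        \<le> B * (\<integral>\<^sup>+y\<in>l c. ennreal (norm (f y) * w y) \<partial>lebesgue)"
      unfolding K_def
      by (rule nn_integral_average_times_weight_le[OF _ _ _ _ w0 B_def])
        (use BA A_fin A_def in \<open>auto intro: le_less_trans\<close>)
    also have "\<dots> \<le> A * (\<integral>\<^sup>+y\<in>l c. ennreal (norm (f y) * w y) \<partial>lebesgue)"
      by (intro mult_right_mono BA) simp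
    finally show ?thesis .
  qed
  have l_sub: "l c \<subseteq> dilated_Q 7 z" if c: "c \<in> Q_star \<delta> z" for c
  proof -
    have "\<rho> c \<le> 2" using PiE_mem[OF \<rho>[unfolded Gamma_family_def] c] by auto
    moreover have "\<Phi> z \<rho> c \<in> sides c (\<rho> c)"
      using sel \<rho> c by (auto simp: side_selection_def)
    ultimately show ?thesis
      unfolding l_def using nbhd_side_subset_dilated_Q[OF \<delta>(2) c] by blast
  qed
  \<comment> \<open>At a point of \<open>Q z\<close> the summand of its own cell equals the
    integrand; the other summands are non-negative, so disjointness of the cells is not
    invoked.\<close>
  have "L1_norm (Q z) w (M_tilde \<delta> \<Phi> z \<rho> f)
      \<le> (\<integral>\<^sup>+x. (\<Sum>c\<in>Q_star \<delta> z. ennreal (norm (K c) * w x) * indicator (square c \<delta>) x) \<partial>lebesgue)"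
    unfolding L1_norm_def
  proof (intro nn_integral_mono)
    fix x
    show "ennreal (norm (M_tilde \<delta> \<Phi> z \<rho> f x) * w x) * indicator (Q z) x
        \<le> (\<Sum>c\<in>Q_star \<delta> z. ennreal (norm (K c) * w x) * indicator (square c \<delta>) x)"
    proof (cases "x \<in> Q z")
      case True
      define c where "c = star \<delta> z x"
      have c: "c \<in> Q_star \<delta> z" "x \<in> square c \<delta>"
        using star_properties[OF \<delta>(1,3) True] by (simp_all add: c_def)
      have "ennreal (norm (M_tilde \<delta> \<Phi> z \<rho> f x) * w x) * indicator (Q z) x
          = ennreal (norm (K c) * w x) * indicator (square c \<delta>) x"
        using True c(2) by (simp add: M_tilde_def K_def l_def c_def Let_def)
      also have "\<dots> \<le> (\<Sum>c\<in>Q_star \<delta> z. ennreal (norm (K c) * w x) * indicator (square c \<delta>) x)"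
        by (rule member_le_sum[OF c(1)]) (simp_all add: fin)
      finally show ?thesis .
    qed simp
  qed
  also have "\<dots> = (\<Sum>c\<in>Q_star \<delta> z. \<integral>\<^sup>+x\<in>square c \<delta>. ennreal (norm (K c) * w x) \<partial>lebesgue)"
    by (rule nn_integral_sum) measurable
  also have "\<dots> \<le> (\<Sum>c\<in>Q_star \<delta> z. A * (\<integral>\<^sup>+y\<in>l c. ennreal (norm (f y) * w y) \<partial>lebesgue))"
    by (intro sum_mono piece)
  also have "\<dots> = A * (\<Sum>c\<in>Q_star \<delta> z. \<integral>\<^sup>+y\<in>l c. ennreal (norm (f y) * w y) \<partial>lebesgue)"
    by (simp add: sum_distrib_left)
  also have "(\<Sum>c\<in>Q_star \<delta> z. \<integral>\<^sup>+y\<in>l c. ennreal (norm (f y) * w y) \<partial>lebesgue)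
      = (\<integral>\<^sup>+y. (\<Sum>c\<in>Q_star \<delta> z. ennreal (norm (f y) * w y) * indicator (l c) y) \<partial>lebesgue)"
    by (rule nn_integral_sum[symmetric]) measurable
  also have "\<dots> \<le> (\<integral>\<^sup>+y. D * (ennreal (norm (f y) * w y) * indicator (dilated_Q 7 z) y) \<partial>lebesgue)"
  proof (intro nn_integral_mono)
    fix y
    show "(\<Sum>c\<in>Q_star \<delta> z. ennreal (norm (f y) * w y) * indicator (l c) y)
        \<le> D * (ennreal (norm (f y) * w y) * indicator (dilated_Q 7 z) y)"
    proof (cases "y \<in> dilated_Q 7 z")
      case True
      have "(\<Sum>c\<in>Q_star \<delta> z. ennreal (norm (f y) * w y) * indicator (l c) y)
          = ennreal (norm (f y) * w y) * (\<Sum>c\<in>Q_star \<delta> z. indicator (l c) y)"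
        by (simp add: sum_distrib_left)
      also have "\<dots> \<le> ennreal (norm (f y) * w y) * D"
        unfolding l_def D_def by (intro mult_left_mono sum_indicator_nbhd_le[OF \<delta>(1) sel \<rho>]) simp
      finally show ?thesis using True by (simp add: mult.commute)
    next
      case False
      \<comment> \<open>Off the dilated square every indicator vanishes, so only the norm of
        \<open>f\<close> over \<open>dilated_Q 7 z\<close> enters.\<close>
      then have "y \<notin> l c" if "c \<in> Q_star \<delta> z" for c using l_sub[OF that] by blast
      then show ?thesis by (simp add: False)
    qed
  qed
  also have "\<dots> = D * L1_norm (dilated_Q 7 z) w f"
    unfolding L1_norm_def by (rule nn_integral_cmult) measurable
  finally show ?thesis
    unfolding A_def D_def by (simp add: mult_left_mono mult.left_commute mult.assoc)
qed

theorem corollary1p12: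
  shows "\<forall>C0::real. \<exists>C::real. C > 0 \<and>
    (\<forall>(\<delta>::real) (\<Phi>::selection) (z::int^2) (\<rho>::real^2 \<Rightarrow> real)
       (w::real^2 \<Rightarrow> real) (f::real^2 \<Rightarrow> complex).
       0 < \<delta> \<longrightarrow> \<delta> < 1 \<longrightarrow> 1 / \<delta> \<in> \<nat> \<longrightarrow>
       side_selection C0 \<delta> \<Phi> \<longrightarrow> \<rho> \<in> Gamma_family \<delta> z \<longrightarrow>
       weight w \<longrightarrow> A1_const \<delta> \<Phi> z \<rho> w < \<infinity> \<longrightarrow> locally_integrable f \<longrightarrow>
       L1_norm (Q z) w (M_tilde \<delta> \<Phi> z \<rho> f)
         \<le> ennreal (C * \<delta> powr (- 5 / 4)) * A1_const \<delta> \<Phi> z \<rho> w * L1_norm (dilated_Q 7 z) w f)"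
proof (intro allI exI conjI impI)
  fix C0 :: real
  \<comment> \<open>\<open>C0\<close> is an arbitrary real; the absolute value and the added 1 make
    the constant positive even when \<open>C0\<close> is not.\<close>
  show "0 < 4 * \<bar>C0\<bar> + 1" by simp
  fix \<delta> :: real and \<Phi> :: selection and z :: "int^2" and \<rho> w and f :: "real^2 \<Rightarrow> complex"
  assume H: "0 < \<delta>" "\<delta> < 1" "1 / \<delta> \<in> \<nat>" "side_selection C0 \<delta> \<Phi>" "\<rho> \<in> Gamma_family \<delta> z"
    "weight w" "A1_const \<delta> \<Phi> z \<rho> w < \<infinity>" "locally_integrable f"
  have "4 * C0 * \<delta> powr (- 5 / 4) \<le> (4 * \<bar>C0\<bar> + 1) * \<delta> powr (- 5 / 4)"
    by (intro mult_right_mono) auto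
  then show "L1_norm (Q z) w (M_tilde \<delta> \<Phi> z \<rho> f)
      \<le> ennreal ((4 * \<bar>C0\<bar> + 1) * \<delta> powr (- 5 / 4)) * A1_const \<delta> \<Phi> z \<rho> w * L1_norm (dilated_Q 7 z) w f"
    by (intro order_trans[OF L1_norm_M_tilde_le[OF H]] mult_right_mono ennreal_leI) simp_all
qed

end
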